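(* Let $x$ be an irrational real number and let $u$ be a finite $\infty$-rational. Then $u$ is a convergent of the EICF expansion of $x$ if and only if there is a $1$-rational $v$ adjacent to $u$ in the Farey graph such that $x$ lies between $u$ and $v$ on the real line.
   Context: Rationals are written in reduced form $a/b$ with $a,b$ coprime integers and $b>0$; $\infty$ is identified with $1/0$. The Farey graph has vertex set $\mathbb{Q}\cup\{\infty\}$, and two vertices $a/b$ and $c/d$ are adjacent if and only if $|ad-bc|=1$. The $\infty$-rationals are the reduced rationals $a/b$ whose numerator and denominator differ in parity, together with the point $\infty$; a finite $\infty$-rational is one other than $\infty$. The $1$-rationals are the reduced rationals $a/b$ with both $a$ and $b$ odd. An even-integer continued fraction (EICF) is a finite, infinite or empty sequence $[b_1,b_2,\dotsc]$ of even integers all of whose terms, except possibly $b_1$, are nonzero. The value of a finite EICF $[b_1,\dots,b_n]$ ($n\geq 1$) is the number $b_1+\cfrac{1}{b_2+\cfrac{1}{b_3+\cdots+\cfrac{1}{b_n}}}$. The convergents of an EICF $[b_1,b_2,\dotsc]$ are the values of $[b_1,\dots,b_n]$ for $n=1,2,\dotsc$. An infinite EICF has value $x$ if its sequence of convergents converges to $x$ in $\mathbb{R}_\infty=\mathbb{R}\cup\{\infty\}$. An EICF expansion of a real number $x$ is an EICF with value $x$; each irrational has a unique EICF expansion, and it is infinite. *)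

theory Defs
  imports "HOL-Analysis.Analysis"
begin

(* Adjoining the point infinity to the rationals or the reals is modelled by the
   option type: None is infinity, Some q is the finite point q. *)

fun reduced_form :: "rat option \<Rightarrow> int \<times> int" where
  "reduced_form None = (1, 0)"
| "reduced_form (Some q) = quotient_of q"

definition farey_adjacent :: "rat option \<Rightarrow> rat option \<Rightarrow> bool" where
  "farey_adjacent r s \<longleftrightarrow>
     (case (reduced_form r, reduced_form s) of
        ((a, b), (c, d)) \<Rightarrow> \<bar>a * d - b * c\<bar> = 1)"

definition infinity_rational :: "rat option \<Rightarrow> bool" where
  "infinity_rational r \<longleftrightarrow>
     (case r of
        None \<Rightarrow> True
      | Some q \<Rightarrow> (case quotient_of q of (a, b) \<Rightarrow> even a \<noteq> even b))"

definition one_rational :: "rat \<Rightarrow> bool" where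
  "one_rational q \<longleftrightarrow> (case quotient_of q of (a, b) \<Rightarrow> odd a \<and> odd b)"

(* Integer sequences, finite (possibly empty) or infinite.  Indices start at 0, so the
   term written b_1 in the usual notation is the term with index 0. *)
datatype int_seq = Fin "int list" | Inf "nat \<Rightarrow> int"

fun is_eicf :: "int_seq \<Rightarrow> bool" where
  "is_eicf (Fin bs) \<longleftrightarrow>
     (\<forall>i<length bs. even (bs ! i)) \<and> (\<forall>i<length bs. i > 0 \<longrightarrow> bs ! i \<noteq> 0)"
| "is_eicf (Inf b) \<longleftrightarrow>
     (\<forall>i. even (b i)) \<and> (\<forall>i>0. b i \<noteq> 0)"

(* No value is assigned to the empty list.  The division is never by zero when the list
   is an even-integer continued fraction; see cf_value_denominator_nonzero. *)
fun cf_value :: "int list \<Rightarrow> real" where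
  "cf_value [b] = of_int b"
| "cf_value (b # c # bs) = of_int b + 1 / cf_value (c # bs)"

lemma cf_value_abs_gt_1:
  assumes "bs \<noteq> []" "\<forall>b\<in>set bs. even b \<and> b \<noteq> 0"
  shows "\<bar>cf_value bs\<bar> > 1"
  using assms
proof (induction bs rule: cf_value.induct)
  case (1 b)
  then have "\<bar>b\<bar> > 1" by auto
  then show ?case by (simp flip: of_int_abs)
next
  case (2 b c bs)
  let ?t = "cf_value (c # bs)"
  have t: "\<bar>?t\<bar> > 1" using 2 by simp
  have "\<bar>1 / ?t\<bar> < 1" using t by simp
  moreover have "\<bar>b\<bar> \<ge> 2"
    using 2(3) by (auto elim!: evenE)
  then have "\<bar>real_of_int b\<bar> \<ge> 2" by linarith
  ultimately have "\<bar>of_int b + 1 / ?t\<bar> > 1" by linarith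
  then show ?case by simp
qed simp

lemma cf_value_denominator_nonzero:
  assumes "is_eicf (Fin (b # c # bs))"
  shows "cf_value (c # bs) \<noteq> 0"
proof -
  have "even d \<and> d \<noteq> 0" if d: "d \<in> set (c # bs)" for d
  proof -
    obtain i where "i < length (c # bs)" "(c # bs) ! i = d"
      using d by (meson in_set_conv_nth)
    then have "Suc i < length (b # c # bs)" "(b # c # bs) ! Suc i = d" by simp_all
    then show ?thesis
      using assms by (metis is_eicf.simps(1) zero_less_Suc)
  qed
  then have "\<bar>cf_value (c # bs)\<bar> > 1"
    by (intro cf_value_abs_gt_1) auto
  then show ?thesis by auto
qed

fun convergents :: "int_seq \<Rightarrow> real set" where
  "convergents (Fin bs) = {cf_value (take n bs) |n. 1 \<le> n \<and> n \<le> length bs}"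
| "convergents (Inf b) = {cf_value (map b [0..<n]) |n. 1 \<le> n}"

abbreviation extended_real_line :: "real option topology" where
  "extended_real_line \<equiv> Alexandroff_compactification euclideanreal"

fun has_value :: "int_seq \<Rightarrow> real option \<Rightarrow> bool" where
  "has_value (Fin bs) x \<longleftrightarrow> bs \<noteq> [] \<and> x = Some (cf_value bs)"
| "has_value (Inf b) x \<longleftrightarrow>
     limitin extended_real_line (\<lambda>n. Some (cf_value (map b [0..<Suc n]))) x sequentially"

lemma has_value_Inf_Some:
  "has_value (Inf b) (Some x) \<longleftrightarrow> (\<lambda>n. cf_value (map b [0..<Suc n])) \<longlonglongrightarrow> x"
proof
  let ?f = "\<lambda>n. cf_value (map b [0..<Suc n])"
  assume L: "has_value (Inf b) (Some x)"
  show "?f \<longlonglongrightarrow> x"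
  proof (rule topological_tendstoI)
    fix S assume S: "open S" "x \<in> S"
    then have "openin extended_real_line (Some ` S)"
      by simp
    then have "\<forall>\<^sub>F n in sequentially. Some (?f n) \<in> Some ` S"
      using L S unfolding has_value.simps limitin_def by blast
    then show "\<forall>\<^sub>F n in sequentially. ?f n \<in> S"
      by (auto elim: eventually_mono)
  qed
next
  assume "(\<lambda>n. cf_value (map b [0..<Suc n])) \<longlonglongrightarrow> x"
  then have "limitin euclideanreal (\<lambda>n. cf_value (map b [0..<Suc n])) x sequentially"
    unfolding limitin_canonical_iff .
  moreover have "continuous_map euclideanreal extended_real_line Some"
    using embedding_map_Some homeomorphic_imp_continuous_map
    by (fastforce simp: embedding_map_def continuous_map_in_subtopology)
  ultimately show "has_value (Inf b) (Some x)"
    using continuous_map_limit by (fastforce simp: o_def)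
qed

definition is_eicf_expansion :: "int_seq \<Rightarrow> real \<Rightarrow> bool" where
  "is_eicf_expansion e x \<longleftrightarrow> is_eicf e \<and> has_value e (Some x)"

(* Meaningful for irrational x, which have exactly one expansion; a rational can have several. *)
definition eicf_expansion :: "real \<Rightarrow> int_seq" where
  "eicf_expansion x = (THE e. is_eicf_expansion e x)"

end

theory Submission
  imports Defs
begin

text \<open>
  The expansion of \<open>x\<close> is produced by repeatedly subtracting the nearest even integer and
  inverting.  Consequently \<open>u\<close> is a convergent of \<open>x\<close> iff \<open>x = (p X + p') / (q X + q')\<close> with
  \<open>u = p / q\<close> and \<open>\<bar>X\<bar> > 1\<close>, for an integer matrix of determinant \<open>\<plusminus>1\<close> with \<open>\<bar>q'\<bar> < \<bar>q\<bar>\<close> that is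
  congruent modulo 2 to the identity or to the swap; such matrices are exactly the products of
  steps of the expansion up to signs, by the Euclidean algorithm with even quotients.
  After normalising signs so that \<open>X > 1\<close>, the Moebius map sends \<open>\<infinity>\<close> to \<open>u\<close> and \<open>1\<close> to the 1-rational
  \<open>v = (p + p') / (q + q')\<close>, and it is monotone on \<open>(1, \<infinity>)\<close>, so \<open>x\<close> lies between \<open>u\<close> and \<open>v\<close>.
  Conversely, among the 1-rationals adjacent to \<open>u\<close> on a given side the one with denominator
  below \<open>2 q\<close> is the farthest from \<open>u\<close>, so it may be used in place of \<open>v\<close>.
\<close>

section \<open>Continued fractions with a real last term\<close>

text \<open>The last term \<open>X\<close> may be any real number, so that an irrational can be
  written as a finite list of integers followed by its complete quotient.\<close>

abbreviation cf_with_tail :: "int list \<Rightarrow> real \<Rightarrow> real" where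
  "cf_with_tail bs X \<equiv> foldr (\<lambda>b y. of_int b + 1 / y) bs X"

lemma cf_value_snoc: "cf_value (bs @ [b]) = cf_with_tail bs (of_int b)"
proof (induction bs)
  case (Cons a bs)
  then show ?case by (cases bs) simp_all
qed simp

lemma cf_value_Cons: "bs \<noteq> [] \<Longrightarrow> cf_value (b # bs) = of_int b + 1 / cf_value bs"
  by (cases bs) simp_all

lemma cf_value_rational: "bs \<noteq> [] \<Longrightarrow> cf_value bs \<in> \<rat>"
  by (induction bs rule: cf_value.induct) auto

lemma abs_even_nonzero_ge_2: "even (b::int) \<Longrightarrow> b \<noteq> 0 \<Longrightarrow> \<bar>b\<bar> \<ge> 2"
  by (auto elim!: evenE)

lemma abs_even_plus_inverse_gt_1:
  assumes "even (b::int)" "b \<noteq> 0" "\<bar>y::real\<bar> > 1"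
  shows "\<bar>of_int b + 1 / y\<bar> > 1"
proof -
  have "\<bar>real_of_int b\<bar> \<ge> 2" using abs_even_nonzero_ge_2[OF assms(1,2)] by linarith
  moreover have "\<bar>1 / y\<bar> < 1" using assms by simp
  ultimately show ?thesis by linarith
qed

lemma abs_cf_with_tail_gt_1:
  assumes "\<forall>b\<in>set bs. even b \<and> b \<noteq> 0" "\<bar>X\<bar> > 1"
  shows "\<bar>cf_with_tail bs X\<bar> > 1"
  using assms by (induction bs) (auto intro: abs_even_plus_inverse_gt_1)

subsection \<open>The nearest-even-integer algorithm\<close>

definition nearest_even :: "real \<Rightarrow> int" where
  "nearest_even x = 2 * \<lfloor>(x + 1) / 2\<rfloor>"

text \<open>The analogue of the Gauss map: it passes from one complete quotient to the next. The
  division is never by zero at an irrational.\<close>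

definition eicf_step :: "real \<Rightarrow> real" where
  "eicf_step x = 1 / (x - of_int (nearest_even x))"

definition eicf_coeff :: "real \<Rightarrow> nat \<Rightarrow> int" where
  "eicf_coeff x n = nearest_even ((eicf_step ^^ n) x)"

lemma even_nearest_even [simp]: "even (nearest_even x)"
  by (simp add: nearest_even_def)

lemma nearest_even_unique:
  assumes "even b" "\<bar>x - of_int b\<bar> < 1"
  shows "nearest_even x = b"
proof -
  obtain c where b: "b = 2 * c" using assms(1) by (auto elim: evenE)
  have "\<lfloor>(x + 1) / 2\<rfloor> = c"
    using assms(2) unfolding b by (intro floor_unique) (auto simp: abs_if split: if_splits)
  then show ?thesis by (simp add: nearest_even_def b)
qed

lemma nearest_even_dist:
  assumes "x \<notin> \<rat>"
  shows "\<bar>x - of_int (nearest_even x)\<bar> < 1"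
proof -
  define k where "k = \<lfloor>(x + 1) / 2\<rfloor>"
  have "real_of_int k \<le> (x + 1) / 2" "(x + 1) / 2 < real_of_int k + 1"
    unfolding k_def by linarith+
  \<comment> \<open>Only an odd integer is at distance exactly 1 from the even integer chosen, and
    irrationality excludes it.\<close>
  moreover have "x \<noteq> of_int (2 * k - 1)"
    using assms Rats_of_int by metis
  ultimately show ?thesis unfolding nearest_even_def k_def[symmetric] by (simp add: abs_less_iff)
qed

lemma eicf_step_irrational:
  assumes "x \<notin> \<rat>"
  shows "eicf_step x \<notin> \<rat>"
proof
  assume "eicf_step x \<in> \<rat>"
  then have "of_int (nearest_even x) + 1 / eicf_step x \<in> \<rat>" by simp
  then show False using assms by (simp add: eicf_step_def)
qed

lemma eicf_step_gt_1:
  assumes "x \<notin> \<rat>"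
  shows "\<bar>eicf_step x\<bar> > 1"
proof -
  have "x - of_int (nearest_even x) \<noteq> 0" using assms by (metis Rats_of_int eq_iff_diff_eq_0)
  then show ?thesis using nearest_even_dist[OF assms] by (simp add: eicf_step_def)
qed

lemma eicf_iterate_irrational: "x \<notin> \<rat> \<Longrightarrow> (eicf_step ^^ n) x \<notin> \<rat>"
  by (induction n) (auto simp: eicf_step_irrational)

lemma eicf_coeff_0: "eicf_coeff x 0 = nearest_even x"
  by (simp add: eicf_coeff_def)

lemma eicf_coeff_Suc: "eicf_coeff x (Suc n) = eicf_coeff (eicf_step x) n"
  by (simp only: eicf_coeff_def funpow_Suc_right o_apply)

lemma eicf_coeff_nonzero:
  assumes "x \<notin> \<rat>" "n > 0"
  shows "eicf_coeff x n \<noteq> 0"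
proof -
  obtain m where n: "n = Suc m" using assms(2) gr0_conv_Suc by auto
  have "\<bar>(eicf_step ^^ n) x\<bar> > 1"
    by (simp add: n eicf_step_gt_1 eicf_iterate_irrational assms)
  then show ?thesis
    using nearest_even_dist[OF eicf_iterate_irrational[OF assms(1), of n]]
    by (auto simp: eicf_coeff_def)
qed

lemma even_eicf_coeff [simp]: "even (eicf_coeff x n)"
  by (simp add: eicf_coeff_def)

lemma map_upt_Suc_shift: "map f [0..<Suc n] = f 0 # map (\<lambda>i. f (Suc i)) [0..<n]"
  by (simp add: upt_conv_Cons map_Suc_upt[symmetric] o_def del: upt_Suc)

text \<open>The invariant of the algorithm: after \<open>n\<close> steps the tail is the complete
  quotient \<open>(eicf_step ^^ n) x\<close>.\<close>

lemma cf_with_tail_eicf_coeff: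
  "cf_with_tail (map (eicf_coeff x) [0..<n]) ((eicf_step ^^ n) x) = x"
proof (induction n arbitrary: x)
  case (Suc n)
  show ?case
    unfolding map_upt_Suc_shift funpow_Suc_right o_apply eicf_coeff_Suc
    using Suc[of "eicf_step x"] by (simp add: eicf_coeff_0) (simp add: eicf_step_def)
qed simp

lemma nearest_even_plus_inverse:
  assumes "even b" "\<bar>y\<bar> > 1"
  shows "nearest_even (of_int b + 1 / y) = b" "eicf_step (of_int b + 1 / y) = y"
proof -
  show "nearest_even (of_int b + 1 / y) = b"
    using assms by (intro nearest_even_unique) auto
  then show "eicf_step (of_int b + 1 / y) = y" by (simp add: eicf_step_def)
qed

text \<open>Every proper tail has absolute value above 1, so its inverse moves the leading term by
  less than 1. That term is therefore the nearest even integer, and the algorithm recovers the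
  list.\<close>

lemma cf_with_tail_unique:
  assumes "\<forall>b\<in>set bs. even b" "0 \<notin> set (tl bs)" "\<bar>X\<bar> > 1"
  shows "map (eicf_coeff (cf_with_tail bs X)) [0..<length bs] = bs"
  using assms
proof (induction bs)
  case (Cons b bs)
  let ?y = "cf_with_tail bs X"
  have y: "\<bar>?y\<bar> > 1" using Cons.prems by (intro abs_cf_with_tail_gt_1) auto
  have "0 \<notin> set (tl bs)" using Cons.prems by (cases bs) auto
  then have "map (eicf_coeff ?y) [0..<length bs] = bs" using Cons by simp
  then show ?case
    unfolding list.size(4) add_Suc_right add_0_right map_upt_Suc_shift eicf_coeff_Suc
    using nearest_even_plus_inverse[OF _ y, of b] Cons.prems(1) by (simp add: eicf_coeff_0)
qed simp

subsection \<open>Expansions and integer matrices\<close>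

text \<open>The columns \<open>(p, q)\<close> and \<open>(p', q')\<close> are, up to signs, the
  current and the previous convergent. With odd determinant, the two parity conditions say that the
  matrix is the identity or the swap modulo 2.\<close>

definition eicf_matrix :: "int \<Rightarrow> int \<Rightarrow> int \<Rightarrow> int \<Rightarrow> bool" where
  "eicf_matrix p q p' q' \<longleftrightarrow>
     \<bar>p * q' - p' * q\<bar> = 1 \<and> \<bar>q'\<bar> < \<bar>q\<bar> \<and> odd (p + p') \<and> odd (q + q')"

definition mobius :: "int \<Rightarrow> int \<Rightarrow> int \<Rightarrow> int \<Rightarrow> real \<Rightarrow> real" where
  "mobius p q p' q' Y = (of_int p * Y + of_int p') / (of_int q * Y + of_int q')"

lemma mobius_denominator:
  assumes "\<bar>q'\<bar> < \<bar>q\<bar>" "\<bar>Y::real\<bar> > 1"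
  shows "\<bar>of_int q * Y + of_int q'\<bar> > \<bar>real_of_int q\<bar> - \<bar>of_int q'\<bar>"
proof -
  have "\<bar>real_of_int q\<bar> * 1 < \<bar>real_of_int q\<bar> * \<bar>Y\<bar>"
    using assms by (intro mult_strict_left_mono) auto
  then have "\<bar>real_of_int q\<bar> < \<bar>of_int q * Y\<bar>" by (simp add: abs_mult)
  then show ?thesis by linarith
qed

lemma mobius_denominator_nonzero:
  assumes "\<bar>q'\<bar> < \<bar>q\<bar>" "\<bar>Y::real\<bar> > 1"
  shows "of_int q * Y + of_int q' \<noteq> 0"
  using mobius_denominator[OF assms] assms(1) by linarith

text \<open>Composition with one step \<open>b + 1 / Y\<close> multiplies the matrix on the right by
  the one with rows \<open>b, 1\<close> and \<open>1, 0\<close>.\<close>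

lemma mobius_plus_inverse:
  assumes "Y \<noteq> 0"
  shows "mobius p q p' q' (of_int b + 1 / Y) = mobius (b * p + p') (b * q + q') p q Y"
proof -
  have "mobius p q p' q' (of_int b + 1 / Y) =
    ((of_int p * (of_int b + 1 / Y) + of_int p') * Y) / ((of_int q * (of_int b + 1 / Y) + of_int q') * Y)"
    using assms by (simp add: mobius_def)
  also have "\<dots> = mobius (b * p + p') (b * q + q') p q Y"
    using assms by (simp add: mobius_def algebra_simps)
  finally show ?thesis .
qed

lemma mobius_of_int:
  "mobius p q p' q' (of_int b) = of_int (b * p + p') / of_int (b * q + q')"
  by (simp add: mobius_def mult.commute)

text \<open>Induction on appending a term, by the usual recurrence for convergents. Since
  \<bar>b\<bar> \<ge> 2, each new denominator exceeds the last in absolute value. The resulting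
  bound on the length is what later gives convergence.\<close>

lemma eicf_matrix_of_list:
  assumes "bs \<noteq> []" "\<forall>b\<in>set bs. even b" "0 \<notin> set (tl bs)"
  shows "\<exists>p q p' q'. eicf_matrix p q p' q' \<and> int (length bs) \<le> \<bar>q\<bar> \<and>
    (\<forall>Y. \<bar>Y\<bar> > 1 \<longrightarrow> cf_with_tail bs Y = mobius p q p' q' Y) \<and> cf_value bs = of_int p / of_int q"
  using assms
proof (induction bs rule: rev_nonempty_induct)
  case (single b)
  show ?case
    using single by (intro exI[of _ b] exI[of _ 1] exI[of _ 0])
      (auto simp: eicf_matrix_def mobius_def field_simps)
next
  case (snoc b bs)
  have b: "even b" "b \<noteq> 0" using snoc.prems snoc.hyps by auto
  have "0 \<notin> set (tl bs)" using snoc.prems snoc.hyps by auto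
  then obtain p q p' q' where
    M: "eicf_matrix p q p' q'" and len: "int (length bs) \<le> \<bar>q\<bar>" and
    tail: "\<And>Y. \<bar>Y\<bar> > 1 \<Longrightarrow> cf_with_tail bs Y = mobius p q p' q' Y"
    using snoc by auto
  have "2 * \<bar>q\<bar> \<le> \<bar>b\<bar> * \<bar>q\<bar>" using abs_even_nonzero_ge_2[OF b] by (intro mult_right_mono) auto
  then have q: "2 * \<bar>q\<bar> \<le> \<bar>b * q\<bar>" by (simp add: abs_mult)
  have "(b * p + p') * q - p * (b * q + q') = - (p * q' - p' * q)" by (simp add: algebra_simps)
  then have "eicf_matrix (b * p + p') (b * q + q') p q"
    using M b q unfolding eicf_matrix_def by auto
  moreover have "int (length (bs @ [b])) \<le> \<bar>b * q + q'\<bar>"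
    using M q len unfolding eicf_matrix_def by auto
  moreover have "cf_with_tail (bs @ [b]) Y = mobius (b * p + p') (b * q + q') p q Y"
    if "\<bar>Y\<bar> > 1" for Y
    using that tail[OF abs_even_plus_inverse_gt_1[OF b that]]
    by (subst mobius_plus_inverse[symmetric]) auto
  \<comment> \<open>The convergent itself is the old Moebius map at \<open>Y = b\<close>, which is
    an admissible tail.\<close>
  moreover have "\<bar>real_of_int b\<bar> > 1" using abs_even_nonzero_ge_2[OF b] by linarith
  then have "cf_value (bs @ [b]) = of_int (b * p + p') / of_int (b * q + q')"
    using tail[of "of_int b"] by (simp only: cf_value_snoc mobius_of_int)
  ultimately show ?case by blast
qed

text \<open>Division with remainder modulo \<open>2 * \<bar>q'\<bar>\<close>, centred at 0. Opposite
  parity of \<open>q\<close> and \<open>q'\<close> rules out the remainder of absolute value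
  \<bar>q'\<bar>, and \<bar>q'\<bar> < \<bar>q\<bar> rules out quotient 0.\<close>

lemma even_quotient_exists:
  assumes "\<bar>q'\<bar> < \<bar>q\<bar>" "q' \<noteq> 0" "coprime q q'" "odd (q + q')"
  obtains b :: int where "even b" "b \<noteq> 0" "\<bar>q - b * q'\<bar> < \<bar>q'\<bar>"
proof -
  define m where "m = 2 * \<bar>q'\<bar>"
  define r where "r = (q + \<bar>q'\<bar>) mod m"
  define k where "k = (q + \<bar>q'\<bar>) div m"
  have m: "m > 0" using assms by (simp add: m_def)
  have r: "0 \<le> r" "r < m" using m by (simp_all add: r_def)
  have qk: "q + \<bar>q'\<bar> = m * k + r" by (simp add: k_def r_def)
  have "odd (q + \<bar>q'\<bar>)" using assms(4) by simp
  then have "odd r" using qk by (simp add: m_def)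
  then have r0: "r \<noteq> 0" by auto
  \<comment> \<open>The division was by \<bar>q'\<bar>; the sign turns \<open>k\<close> into a
    quotient with respect to \<open>q'\<close>.\<close>
  let ?b = "2 * k * sgn q'"
  have eq: "q - ?b * q' = r - \<bar>q'\<bar>"
    using qk by (simp add: m_def algebra_simps abs_sgn)
  then have lt: "\<bar>q - ?b * q'\<bar> < \<bar>q'\<bar>" using r r0 by (auto simp: m_def)
  moreover have "?b \<noteq> 0"
  proof
    assume b: "?b = 0"
    show False using lt assms(1) unfolding b by simp
  qed
  ultimately show thesis by (intro that[of ?b]) auto
qed

text \<open>The Euclidean algorithm on the bottom row \<open>(q, q')\<close> strips off the last
  term. A matrix is a product of steps only up to signs, and the sign \<sigma> on the tail absorbs
  the discrepancy.\<close>

lemma list_of_eicf_matrix: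
  assumes "eicf_matrix p q p' q'"
  shows "\<exists>bs \<sigma>. bs \<noteq> [] \<and> (\<forall>b\<in>set bs. even b) \<and> 0 \<notin> set (tl bs) \<and> \<bar>\<sigma>\<bar> = 1 \<and>
    (\<forall>Y. \<bar>Y\<bar> > 1 \<longrightarrow> cf_with_tail bs (of_int \<sigma> * Y) = mobius p q p' q' Y) \<and>
    cf_value bs = of_int p / of_int q"
  using assms
proof (induction "nat \<bar>q'\<bar>" arbitrary: p q p' q' rule: less_induct)
  case less
  note M = less.prems[unfolded eicf_matrix_def]
  show ?case
  proof (cases "q' = 0")
    case True
    then have "\<bar>p'\<bar> * \<bar>q\<bar> = 1" using M by (simp add: abs_mult)
    then have "\<bar>p'\<bar> = 1" "\<bar>q\<bar> = 1" by (auto simp: abs_zmult_eq_1 zmult_eq_1_iff)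
    then have "(p' = 1 \<or> p' = -1) \<and> (q = 1 \<or> q = -1)" by linarith
    moreover from this have "even p" using M by auto
    \<comment> \<open>Here \<open>p'\<close> and \<open>q\<close> are units, so
      \<open>p / q = p * q\<close>, and the remaining \<open>p' / (q * Y)\<close> is the inverse of
      \<open>p' * q * Y\<close>.\<close>
    ultimately show ?thesis using True
      by (intro exI[of _ "[p * q]"] exI[of _ "p' * q"])
         (auto simp: mobius_def divide_simps)
  next
    case False
    have "coprime q q'"
    proof (rule coprimeI)
      fix c assume "c dvd q" "c dvd q'"
      then have "c dvd \<bar>p * q' - p' * q\<bar>" by simp
      then show "is_unit c" using M by simp
    qed
    then obtain b where b: "even b" "b \<noteq> 0" "\<bar>q - b * q'\<bar> < \<bar>q'\<bar>"
      using even_quotient_exists[of q' q] M False by metis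
    have "p' * (q - b * q') - (p - b * p') * q' = - (p * q' - p' * q)" by (simp add: algebra_simps)
    then have "eicf_matrix p' q' (p - b * p') (q - b * q')"
      using M b unfolding eicf_matrix_def by auto
    moreover have "nat \<bar>q - b * q'\<bar> < nat \<bar>q'\<bar>" using b by auto
    ultimately obtain bs \<sigma> where
      bs: "bs \<noteq> []" "\<forall>b\<in>set bs. even b" "0 \<notin> set (tl bs)" and \<sigma>: "\<bar>\<sigma>\<bar> = 1" and
      tail: "\<And>Y. \<bar>Y\<bar> > 1 \<Longrightarrow>
        cf_with_tail bs (of_int \<sigma> * Y) = mobius p' q' (p - b * p') (q - b * q') Y"
      using less.hyps by meson
    have \<sigma>': "\<sigma> = 1 \<or> \<sigma> = -1" using \<sigma> by linarith
    have "cf_with_tail (bs @ [\<sigma> * b]) (of_int \<sigma> * Y) = mobius p q p' q' Y" if Y: "\<bar>Y\<bar> > 1" for Y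
    proof -
      \<comment> \<open>As \<sigma> is its own inverse, it factors out of the step; this is why the
        appended term is \<open>\<sigma> * b\<close>.\<close>
      have "of_int (\<sigma> * b) + 1 / (of_int \<sigma> * Y) = of_int \<sigma> * (of_int b + 1 / Y)"
        using \<sigma>' by auto
      moreover have "Y \<noteq> 0" using Y by auto
      ultimately show ?thesis
        using tail[OF abs_even_plus_inverse_gt_1[OF b(1,2) Y]] by (simp add: mobius_plus_inverse)
    qed
    moreover have "\<bar>real_of_int b\<bar> > 1" using abs_even_nonzero_ge_2[OF b(1,2)] by linarith
    then have "cf_value (bs @ [\<sigma> * b]) = of_int p / of_int q"
      using tail[of "of_int b"] by (simp add: cf_value_snoc mobius_of_int)
    moreover have "\<forall>b\<in>set (bs @ [\<sigma> * b]). even b" "0 \<notin> set (tl (bs @ [\<sigma> * b]))"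
      using bs b \<sigma>' by auto
    ultimately show ?thesis using \<sigma>
      by (intro exI[of _ "bs @ [\<sigma> * b]"] exI[of _ \<sigma>]) blast
  qed
qed

subsection \<open>Existence and uniqueness of the expansion\<close>

lemma eicf_coeff_list:
  assumes "x \<notin> \<rat>"
  shows "\<forall>b\<in>set (map (eicf_coeff x) [0..<n]). even b" "0 \<notin> set (tl (map (eicf_coeff x) [0..<n]))"
proof -
  show "0 \<notin> set (tl (map (eicf_coeff x) [0..<n]))"
  proof (cases n)
    case (Suc m)
    show ?thesis unfolding Suc map_upt_Suc_shift using eicf_coeff_nonzero[OF assms] by force
  qed simp
qed simp

lemma eicf_convergent_matrix:
  assumes "x \<notin> \<rat>" "n > 0"
  obtains p q p' q' X where "eicf_matrix p q p' q'" "int n \<le> \<bar>q\<bar>" "\<bar>X\<bar> > 1"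
    "x = mobius p q p' q' X" "cf_value (map (eicf_coeff x) [0..<n]) = of_int p / of_int q"
proof -
  let ?bs = "map (eicf_coeff x) [0..<n]"
  let ?X = "(eicf_step ^^ n) x"
  obtain m where "n = Suc m" using assms(2) gr0_conv_Suc by auto
  then have X: "\<bar>?X\<bar> > 1" by (simp add: eicf_step_gt_1 eicf_iterate_irrational assms)
  obtain p q p' q' where "eicf_matrix p q p' q'" "int (length ?bs) \<le> \<bar>q\<bar>"
    "\<forall>Y. \<bar>Y\<bar> > 1 \<longrightarrow> cf_with_tail ?bs Y = mobius p q p' q' Y" "cf_value ?bs = of_int p / of_int q"
    using eicf_matrix_of_list[OF _ eicf_coeff_list[OF assms(1), of n]] assms(2) by auto
  then show thesis using that[of p q p' q' ?X] X cf_with_tail_eicf_coeff[of x n] by auto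
qed

text \<open>By the determinant, the difference is 1 over \<open>q * (q * X + q')\<close> up to sign.
  The second factor exceeds 1 in absolute value because \<bar>q\<bar> and \<bar>q'\<bar> differ by
  at least 1.\<close>

lemma mobius_diff_bound:
  assumes "eicf_matrix p q p' q'" "\<bar>X\<bar> > 1"
  shows "\<bar>mobius p q p' q' X - of_int p / of_int q\<bar> \<le> 1 / \<bar>of_int q\<bar>"
proof -
  note M = assms(1)[unfolded eicf_matrix_def]
  let ?d = "of_int q * X + of_int q'"
  have "\<bar>?d\<bar> > \<bar>real_of_int q\<bar> - \<bar>of_int q'\<bar>" using mobius_denominator M assms(2) by blast
  then have d: "\<bar>?d\<bar> > 1" using M by linarith
  have q: "\<bar>real_of_int q\<bar> > 0" using M by auto
  have det: "\<bar>real_of_int (p * q' - p' * q)\<bar> = 1" using M by linarith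
  have "mobius p q p' q' X - of_int p / of_int q = - of_int (p * q' - p' * q) / (?d * of_int q)"
    using d q by (simp add: mobius_def divide_simps) (auto simp: algebra_simps)
  then have "\<bar>mobius p q p' q' X - of_int p / of_int q\<bar> = 1 / (\<bar>?d\<bar> * \<bar>of_int q\<bar>)"
    using det by (simp only: abs_mult abs_divide abs_minus_cancel)
  also have "\<dots> \<le> 1 / \<bar>of_int q\<bar>" using d q by (intro divide_left_mono) auto
  finally show ?thesis .
qed

lemma eicf_coeff_expansion:
  assumes "x \<notin> \<rat>"
  shows "is_eicf_expansion (Inf (eicf_coeff x)) x"
proof -
  let ?c = "\<lambda>n. cf_value (map (eicf_coeff x) [0..<Suc n])"
  have bound: "\<bar>?c n - x\<bar> \<le> inverse (real (Suc n))" for n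
  proof -
    obtain p q p' q' X where M: "eicf_matrix p q p' q'" "int (Suc n) \<le> \<bar>q\<bar>" "\<bar>X\<bar> > 1"
      "x = mobius p q p' q' X" "?c n = of_int p / of_int q"
      using eicf_convergent_matrix[OF assms, of "Suc n"] by blast
    have "\<bar>?c n - x\<bar> \<le> 1 / \<bar>of_int q\<bar>"
      using mobius_diff_bound[OF M(1,3)] M(4,5) by (simp only: abs_minus_commute)
    also have "\<dots> \<le> 1 / real (Suc n)"
      using M(2) by (intro divide_left_mono) auto
    finally show ?thesis by (simp add: inverse_eq_divide)
  qed
  have "(\<lambda>n. ?c n - x) \<longlonglongrightarrow> 0"
    by (rule Lim_null_comparison[OF _ LIMSEQ_inverse_real_of_nat]) (use bound in simp)
  then have "?c \<longlonglongrightarrow> x" by (rule LIM_zero_cancel)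
  then show ?thesis
    unfolding is_eicf_expansion_def has_value_Inf_Some
    using eicf_coeff_nonzero[OF assms] by simp
qed

text \<open>All later convergents are within 1 of \<open>b 0\<close>, hence so is the limit.
  Subtracting \<open>b 0\<close> and inverting then carries convergence over to the shifted
  sequence.\<close>

lemma eicf_limit_step:
  assumes "is_eicf (Inf b)" "(\<lambda>n. cf_value (map b [0..<Suc n])) \<longlonglongrightarrow> x" "x \<notin> \<rat>"
  shows "b 0 = nearest_even x"
    and "(\<lambda>n. cf_value (map (\<lambda>i. b (Suc i)) [0..<Suc n])) \<longlonglongrightarrow> eicf_step x"
proof -
  let ?t = "\<lambda>n. cf_value (map (\<lambda>i. b (Suc i)) [0..<Suc n])"
  let ?c = "\<lambda>n. cf_value (map b [0..<Suc (Suc n)])"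
  have c: "?c n = of_int (b 0) + 1 / ?t n" for n
    by (subst map_upt_Suc_shift, subst cf_value_Cons) simp_all
  have t: "\<bar>?t n\<bar> > 1" for n
    using assms(1) by (intro cf_value_abs_gt_1) auto
  have "?c \<longlonglongrightarrow> x" using LIMSEQ_Suc[OF assms(2)] .
  then have lim: "(\<lambda>n. ?c n - of_int (b 0)) \<longlonglongrightarrow> x - of_int (b 0)" by (intro tendsto_intros)
  have "\<bar>?c n - of_int (b 0)\<bar> \<le> 1" for n using t[of n] by (simp add: c del: upt_Suc)
  then have "\<bar>x - of_int (b 0)\<bar> \<le> 1"
    by (intro LIMSEQ_le_const2[OF tendsto_rabs[OF lim]]) blast
  \<comment> \<open>The first two make the bound on the limit strict; the third permits the
    inversion.\<close>
  moreover have "x \<noteq> of_int (b 0 + 1)" "x \<noteq> of_int (b 0 - 1)" "x \<noteq> of_int (b 0)"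
    using assms(3) Rats_of_int by metis+
  ultimately have lt: "\<bar>x - of_int (b 0)\<bar> < 1" and ne: "x - of_int (b 0) \<noteq> 0" by auto
  show b0: "b 0 = nearest_even x"
    using assms(1) by (intro nearest_even_unique[symmetric] lt) simp
  have "(\<lambda>n. 1 / (?c n - of_int (b 0))) \<longlonglongrightarrow> 1 / (x - of_int (b 0))"
    using lim ne by (intro tendsto_divide tendsto_const)
  then show "?t \<longlonglongrightarrow> eicf_step x"
    unfolding eicf_step_def b0[symmetric] c by simp
qed

lemma eicf_expansion_unique_Inf:
  assumes "is_eicf (Inf b)" "(\<lambda>n. cf_value (map b [0..<Suc n])) \<longlonglongrightarrow> x" "x \<notin> \<rat>"
  shows "b n = eicf_coeff x n"
  using assms
proof (induction n arbitrary: b x)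
  case 0
  then show ?case using eicf_limit_step(1) by (simp add: eicf_coeff_0)
next
  case (Suc n)
  have "is_eicf (Inf (\<lambda>i. b (Suc i)))" using Suc.prems(1) by simp
  from Suc.IH[OF this eicf_limit_step(2)[OF Suc.prems] eicf_step_irrational[OF Suc.prems(3)]]
  show ?case by (simp add: eicf_coeff_Suc)
qed

lemma eicf_expansion_irrational:
  assumes "x \<notin> \<rat>"
  shows "eicf_expansion x = Inf (eicf_coeff x)"
  unfolding eicf_expansion_def
proof (rule the_equality)
  show "is_eicf_expansion (Inf (eicf_coeff x)) x" using eicf_coeff_expansion[OF assms] .
next
  fix e assume e: "is_eicf_expansion e x"
  show "e = Inf (eicf_coeff x)"
  proof (cases e)
    case (Fin bs)
    then show ?thesis
      using e assms cf_value_rational by (auto simp: is_eicf_expansion_def)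
  next
    case (Inf b)
    have "b = eicf_coeff x"
      using e[unfolded Inf is_eicf_expansion_def has_value_Inf_Some]
        eicf_expansion_unique_Inf[of b x] assms by blast
    then show ?thesis by (simp add: Inf)
  qed
qed

text \<open>For the converse, the matrix yields a list with tail \<plusminus>\<open>X\<close>, still
  of absolute value above 1, so uniqueness makes the list an initial segment of the
  expansion.\<close>

lemma convergent_iff_matrix:
  assumes "x \<notin> \<rat>"
  shows "y \<in> convergents (eicf_expansion x) \<longleftrightarrow>
    (\<exists>p q p' q' X. eicf_matrix p q p' q' \<and> \<bar>X\<bar> > 1 \<and> x = mobius p q p' q' X \<and>
       y = of_int p / of_int q)"
proof
  assume "y \<in> convergents (eicf_expansion x)"
  then obtain n where "n > 0" "y = cf_value (map (eicf_coeff x) [0..<n])"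
    by (auto simp: eicf_expansion_irrational[OF assms] Suc_le_eq)
  then show "\<exists>p q p' q' X. eicf_matrix p q p' q' \<and> \<bar>X\<bar> > 1 \<and> x = mobius p q p' q' X \<and>
       y = of_int p / of_int q"
    using eicf_convergent_matrix[OF assms] by metis
next
  assume "\<exists>p q p' q' X. eicf_matrix p q p' q' \<and> \<bar>X\<bar> > 1 \<and> x = mobius p q p' q' X \<and>
       y = of_int p / of_int q"
  then obtain p q p' q' X where M: "eicf_matrix p q p' q'" "\<bar>X\<bar> > 1" "x = mobius p q p' q' X"
    "y = of_int p / of_int q" by blast
  obtain bs \<sigma> where bs: "bs \<noteq> []" "\<forall>b\<in>set bs. even b" "0 \<notin> set (tl bs)" "\<bar>\<sigma>\<bar> = 1"
    "cf_with_tail bs (of_int \<sigma> * X) = x" "cf_value bs = y"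
    using list_of_eicf_matrix[OF M(1)] M(2-4) by metis
  have "\<bar>real_of_int \<sigma>\<bar> = 1" using bs(4) by linarith
  then have "\<bar>of_int \<sigma> * X\<bar> > 1" using M(2) by (simp add: abs_mult)
  from cf_with_tail_unique[OF bs(2,3) this] have "map (eicf_coeff x) [0..<length bs] = bs"
    by (simp only: bs(5))
  then have "y = cf_value (map (eicf_coeff x) [0..<length bs])" by (simp only: bs(6))
  moreover have "1 \<le> length bs" using bs(1) by (simp add: Suc_le_eq)
  ultimately show "y \<in> convergents (eicf_expansion x)"
    unfolding eicf_expansion_irrational[OF assms] convergents.simps by blast
qed

subsection \<open>Farey neighbours\<close>

text \<open>Negating the whole matrix does not change the map, and negating the second column
  compensates for replacing \<open>X\<close> by \<open>-X\<close>.\<close>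

lemma eicf_matrix_normalise:
  assumes "eicf_matrix p q p' q'" "\<bar>X\<bar> > 1"
  obtains P Q P' Q' Y where "eicf_matrix P Q P' Q'" "Q > 0" "Y > 1"
    "mobius P Q P' Q' Y = mobius p q p' q' X" "real_of_int P / of_int Q = of_int p / of_int q"
proof -
  define s where "s = sgn q"
  define e where "e = sgn X"
  have s: "s = 1 \<or> s = -1"
    using assms(1) by (auto simp: eicf_matrix_def s_def sgn_if)
  \<comment> \<open>\<open>e'\<close> is the integer copy of the real sign \<open>e\<close>, as the
    matrix entries are integers.\<close>
  obtain e' :: int where e: "(e' = 1 \<and> e = 1) \<or> (e' = -1 \<and> e = -1)"
    using assms(2) by (cases "X > 0") (auto simp: e_def)
  have q: "q \<noteq> 0" "s * q > 0" using assms(1) by (auto simp: eicf_matrix_def s_def sgn_if)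
  have X: "e * X > 1" using assms(2) by (auto simp: e_def sgn_if)
  show thesis
  proof (rule that[of "s * p" "s * q" "e' * s * p'" "e' * s * q'" "e * X"])
    show "eicf_matrix (s * p) (s * q) (e' * s * p') (e' * s * q')"
      using assms(1) s e unfolding eicf_matrix_def by auto
    have *: "mobius (- p) (- q) (- p') (- q') Y = mobius p q p' q' Y" for p q p' q' Y
    proof -
      have "mobius (- p) (- q) (- p') (- q') Y =
        - (of_int p * Y + of_int p') / - (of_int q * Y + of_int q')"
        by (simp add: mobius_def)
      then show ?thesis unfolding mobius_def minus_divide_divide .
    qed
    show "mobius (s * p) (s * q) (e' * s * p') (e' * s * q') (e * X) = mobius p q p' q' X"
      using s e *[of p q p' q' X] *[of p q "-p'" "-q'" "-X"] *[of "-p" "-q" p' q' "X"]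
      by (auto simp: mobius_def)
    show "real_of_int (s * p) / of_int (s * q) = of_int p / of_int q" using s by auto
  qed (use q X in auto)
qed

lemma quotient_of_Fract_coprime: "coprime a b \<Longrightarrow> b > 0 \<Longrightarrow> quotient_of (Fract a b) = (a, b)"
  by (simp add: quotient_of_Fract Rat.normalize_def)

lemma of_rat_quotient_of:
  assumes "quotient_of r = (a, b)"
  shows "(of_rat r :: real) = of_int a / of_int b"
  using quotient_of_div[OF assms] by (simp add: of_rat_divide)

lemma coprime_of_det:
  assumes "\<bar>a * d - b * c\<bar> = (1::int)"
  shows "coprime a b" "coprime c d"
proof -
  have u: "is_unit k" if "k dvd a * d - b * c" for k
  proof -
    have "k dvd \<bar>a * d - b * c\<bar>" using that by simp
    then show ?thesis using assms by simp
  qed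
  show "coprime a b" "coprime c d" by (rule coprimeI, rule u, simp)+
qed

text \<open>\<open>u\<close> and \<open>v\<close> are the images of \<infinity> and 1. The explicit
  formulas for \<open>x - u\<close> and \<open>x - v\<close> carry the determinant with opposite
  signs over positive denominators.\<close>

lemma mobius_gt_1_between:
  assumes "q > 0" "q + q' > 0" "\<bar>q'\<bar> < \<bar>q\<bar>" "p * q' - p' * q \<noteq> 0" "Y > 1"
  defines "x \<equiv> mobius p q p' q' Y"
    and "u \<equiv> of_int p / of_int q" and "v \<equiv> of_int (p + p') / of_int (q + q')"
  shows "u < x \<and> x < v \<or> v < x \<and> x < u"
proof -
  define D where "D = real_of_int (p * q' - p' * q)"
  define d where "d = of_int q * Y + of_int q'"
  have "real_of_int q * 1 < of_int q * Y" using assms by (intro mult_strict_left_mono) auto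
  then have d: "d > 0" using assms(2) unfolding d_def by linarith
  have q: "real_of_int q > 0" and qq: "real_of_int (q + q') > 0" using assms by simp_all
  have xu: "x - u = - D / (d * of_int q)"
    using d q unfolding x_def u_def mobius_def d_def[symmetric] D_def
    by (simp add: divide_simps) (simp add: d_def algebra_simps)
  have xv: "x - v = D * (Y - 1) / (d * of_int (q + q'))"
    using d qq unfolding x_def v_def mobius_def d_def[symmetric] D_def
    by (simp add: divide_simps) (simp add: d_def algebra_simps)
  have dq: "d * of_int q > 0" "d * of_int (q + q') > 0" using d q qq by simp_all
  have "D \<noteq> 0" using assms(4) by (simp only: D_def of_int_eq_0_iff not_False_eq_True)
  then consider "D > 0" | "D < 0" by linarith
  then show ?thesis
  proof cases
    case 1
    have "x - u < 0" unfolding xu using 1 dq(1) by (intro divide_neg_pos) auto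
    moreover have "D * (Y - 1) > 0" using 1 assms(5) by simp
    then have "x - v > 0" unfolding xv using dq(2) by (rule divide_pos_pos)
    ultimately show ?thesis by simp
  next
    case 2
    then have "D * (Y - 1) < 0" using assms(5) by (simp add: mult_neg_pos)
    then have "x - v < 0" unfolding xv using dq(2) by (rule divide_neg_pos)
    moreover have "x - u > 0" unfolding xu using 2 dq(1) by (intro divide_pos_pos) auto
    ultimately show ?thesis by simp
  qed
qed

text \<open>The witness is the image of 1 under the normalised map. The parity conditions make its
  numerator and denominator odd, and its determinant with \<open>u\<close> is that of the
  matrix.\<close>

lemma one_rational_neighbour_of_matrix:
  assumes "eicf_matrix p q p' q'" "\<bar>X\<bar> > 1" "x = mobius p q p' q' X"
    "(of_rat u :: real) = of_int p / of_int q"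
  shows "\<exists>v. one_rational v \<and> farey_adjacent (Some u) (Some v) \<and>
       (of_rat u < x \<and> x < of_rat v \<or> of_rat v < x \<and> x < of_rat u)"
proof -
  obtain P Q P' Q' Y where M: "eicf_matrix P Q P' Q'" "Q > 0" "Y > 1"
    "x = mobius P Q P' Q' Y" "real_of_int P / of_int Q = of_rat u"
    using eicf_matrix_normalise[OF assms(1,2)] assms(3,4) by metis
  note E = M(1)[unfolded eicf_matrix_def]
  define v where "v = Fract (P + P') (Q + Q')"
  have det: "\<bar>P * (Q + Q') - Q * (P + P')\<bar> = 1" using E by (simp add: algebra_simps)
  have QQ: "Q + Q' > 0" using E M(2) by linarith
  have "(of_rat u :: real) = of_rat (Fract P Q)" using M(2,5) by (simp add: of_rat_rat)
  then have u: "u = Fract P Q" by (simp only: of_rat_eq_iff)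
  have qu: "quotient_of u = (P, Q)" and qv: "quotient_of v = (P + P', Q + Q')"
    unfolding u v_def using coprime_of_det[OF det] M(2) QQ by (auto intro: quotient_of_Fract_coprime)
  have "one_rational v" using qv E by (simp add: one_rational_def)
  moreover have "farey_adjacent (Some u) (Some v)"
    using qu qv det by (simp add: farey_adjacent_def)
  moreover have "P * Q' - P' * Q \<noteq> 0" using E by auto
  then have "of_rat u < x \<and> x < of_rat v \<or> of_rat v < x \<and> x < of_rat u"
    using mobius_gt_1_between[OF M(2) QQ _ _ M(3), of P P'] E
    unfolding M(4) of_rat_quotient_of[OF qu] of_rat_quotient_of[OF qv] by blast
  ultimately show ?thesis by blast
qed

lemma matrix_of_one_rational_neighbour:
  assumes "infinity_rational (Some u)" "one_rational v" "farey_adjacent (Some u) (Some v)"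
    and between: "of_rat u < x \<and> x < of_rat v \<or> of_rat v < x \<and> x < of_rat u"
  shows "\<exists>p q p' q' X. eicf_matrix p q p' q' \<and> \<bar>X\<bar> > 1 \<and> x = mobius p q p' q' X \<and>
       of_rat u = real_of_int p / of_int q"
proof -
  obtain p q where u: "quotient_of u = (p, q)" by force
  obtain r s where v: "quotient_of v = (r, s)" by force
  have q: "q > 0" and s: "s > 0" using u v quotient_of_denom_pos by blast+
  have par: "even p \<noteq> even q" "odd r" "odd s" and det: "\<bar>p * s - q * r\<bar> = 1"
    using assms(1-3) u v by (auto simp: infinity_rational_def one_rational_def farey_adjacent_def)
  \<comment> \<open>Subtracting \<open>2 * k\<close> times \<open>(p, q)\<close> from
    \<open>(r, s)\<close> keeps both the parities and the determinant. It brings the odd denominator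
    strictly between 0 and \<open>2 * q\<close>, which is \<bar>q'\<bar> < q.\<close>
  define k where "k = s div (2 * q)"
  define s0 where "s0 = s - 2 * k * q"
  define r0 where "r0 = r - 2 * k * p"
  define p' where "p' = r0 - p"
  define q' where "q' = s0 - q"
  have k: "k \<ge> 0" using q s by (simp add: k_def pos_imp_zdiv_nonneg_iff)
  have s0_mod: "s0 = s mod (2 * q)" by (simp add: s0_def k_def minus_mult_div_eq_mod[symmetric])
  have "odd s0" using par by (simp add: s0_def)
  moreover have "s0 \<ge> 0" "s0 < 2 * q" using q by (simp_all add: s0_mod)
  ultimately have s0: "s0 > 0" "s0 < 2 * q" by (auto simp: less_le)
  have "p * q' - p' * q = p * s - q * r" by (simp add: p'_def q'_def r0_def s0_def algebra_simps)
  then have M: "eicf_matrix p q p' q'"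
    unfolding eicf_matrix_def using det s0 par by (auto simp: p'_def q'_def r0_def s0_def)
  \<comment> \<open>The solution of \<open>x = mobius p q p' q' X\<close> for
    \<open>X\<close>.\<close>
  define X where "X = (of_int p' - of_int q' * x) / (of_int q * x - of_int p)"
  have ne: "of_int q * x - of_int p \<noteq> 0" and pos: "X - 1 > 0"
  proof -
    have qr: "real_of_int q > 0" and sr: "real_of_int s > 0" using q s by simp_all
    \<comment> \<open>Both summands on the right have the same sign when \<open>x\<close> lies
      between \<open>u\<close> and \<open>v\<close>, because \<open>k\<close> is nonnegative. Thus
      \<open>x\<close> also lies between \<open>u\<close> and the neighbour
      \<open>r0 / s0\<close>.\<close>
    have eq: "of_int r0 - of_int s0 * x =
      (of_int r - of_int s * x) + 2 * of_int k * (of_int q * x - of_int p)"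
      by (simp add: r0_def s0_def algebra_simps)
    have kr: "2 * real_of_int k \<ge> 0" using k by simp
    from between consider
      (1) "of_int q * x - of_int p > 0" "of_int r - of_int s * x > 0"
      | (2) "of_int q * x - of_int p < 0" "of_int r - of_int s * x < 0"
      unfolding of_rat_quotient_of[OF u] of_rat_quotient_of[OF v]
      using qr sr by (auto simp: field_simps)
    note cases = this
    show ne: "of_int q * x - of_int p \<noteq> 0" using cases by cases auto
    have X1: "X - 1 = (of_int r0 - of_int s0 * x) / (of_int q * x - of_int p)"
      using ne unfolding X_def by (simp add: divide_simps) (simp add: p'_def q'_def algebra_simps)
    show "X - 1 > 0" unfolding X1
      using cases
    proof cases
      case 1
      then have "of_int r0 - of_int s0 * x > 0"
        unfolding eq using kr by (intro add_pos_nonneg mult_nonneg_nonneg) auto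
      then show "(of_int r0 - of_int s0 * x) / (of_int q * x - of_int p) > 0" using 1 by simp
    next
      case 2
      then have "of_int r0 - of_int s0 * x < 0"
        unfolding eq using kr by (intro add_neg_nonpos mult_nonneg_nonpos) auto
      then show "(of_int r0 - of_int s0 * x) / (of_int q * x - of_int p) > 0"
        using 2 by (intro divide_neg_neg)
    qed
  qed
  have X: "\<bar>X\<bar> > 1" using pos by simp
  have "of_int q * X + of_int q' \<noteq> 0"
    using mobius_denominator_nonzero[OF _ X] M unfolding eicf_matrix_def by blast
  moreover have "X * (of_int q * x - of_int p) = of_int p' - of_int q' * x"
    using ne by (simp add: X_def)
  ultimately have "x = mobius p q p' q' X"
    by (simp add: mobius_def eq_divide_eq algebra_simps)
  then show ?thesis using M X of_rat_quotient_of[OF u] by blast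
qed

theorem theorem5p1:
  fixes x :: real and u :: rat
  assumes "x \<notin> \<rat>"
    and "infinity_rational (Some u)"
  shows "of_rat u \<in> convergents (eicf_expansion x) \<longleftrightarrow>
    (\<exists>v::rat. one_rational v \<and> farey_adjacent (Some u) (Some v) \<and>
       (of_rat u < x \<and> x < of_rat v \<or> of_rat v < x \<and> x < of_rat u))"
  unfolding convergent_iff_matrix[OF assms(1)]
  using one_rational_neighbour_of_matrix matrix_of_one_rational_neighbour[OF assms(2)] by meson

end
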